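(* Let $k,\Delta\geq 2$ with $\Delta\leq k$, and let $T$ be any $[\Delta,k]$-transversal design. Let $U$ be any block of $T$ and let $t_1,t_2,\ldots,t_\Delta$ be any $\Delta$ nodes or blocks of $T$ (repetitions allowed). Then there are paths $\pi_1,\ldots,\pi_\Delta$ in $T$, where $\pi_i$ goes from $U$ to $t_i$ and has length at most $7$, such that these paths are pairwise edge-disjoint.
   Context: A $[\Delta,k]$-transversal design ($k,\Delta\ge2$) is a set of $\Delta k$ elements partitioned into $\Delta$ groups of size $k$, with a family of $k^2$ blocks, each a $\Delta$-subset meeting every group in exactly one element, such that every pair of elements from distinct groups lies in exactly one block. It is viewed as a bipartite graph with the elements as nodes, the blocks as blocks, and a node adjacent to a block iff it belongs to it. A path is a sequence of distinct vertices with consecutive ones adjacent; its length is its number of edges. A set of paths is pairwise edge-disjoint if no edge is traversed by more than one of the paths (counted over all paths, at most once). *)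

theory Defs
  imports Main "HOL-Library.Disjoint_Sets"
begin

text \<open>
  The blocks form a set rather than a multiset: since \<open>\<Delta> \<ge> 2\<close> and two points of distinct
  groups lie in exactly one block, repeated blocks cannot occur.
\<close>

definition transversal_design ::
  "nat \<Rightarrow> nat \<Rightarrow> 'a set \<Rightarrow> 'a set set \<Rightarrow> 'a set set \<Rightarrow> bool" where
  "transversal_design \<Delta> k X G B \<longleftrightarrow>
     2 \<le> \<Delta> \<and> 2 \<le> k \<and>
     finite X \<and> card X = \<Delta> * k \<and>
     partition_on X G \<and> card G = \<Delta> \<and> (\<forall>g\<in>G. card g = k) \<and>
     card B = k\<^sup>2 \<and>
     (\<forall>b\<in>B. b \<subseteq> X \<and> card b = \<Delta> \<and> (\<forall>g\<in>G. \<exists>!x. x \<in> b \<inter> g)) \<and>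
     (\<forall>g\<in>G. \<forall>h\<in>G. g \<noteq> h \<longrightarrow> (\<forall>x\<in>g. \<forall>y\<in>h. \<exists>!b. b \<in> B \<and> x \<in> b \<and> y \<in> b))"

datatype 'a vertex = Node 'a | Block "'a set"

definition vertices :: "'a set \<Rightarrow> 'a set set \<Rightarrow> 'a vertex set" where
  "vertices X B = Node ` X \<union> Block ` B"

definition edges :: "'a set \<Rightarrow> 'a set set \<Rightarrow> 'a vertex set set" where
  "edges X B = {{Node x, Block b} | x b. x \<in> X \<and> b \<in> B \<and> x \<in> b}"

definition is_path :: "'v set \<Rightarrow> 'v set set \<Rightarrow> 'v list \<Rightarrow> bool" where
  "is_path V E p \<longleftrightarrow>
     p \<noteq> [] \<and> set p \<subseteq> V \<and> distinct p \<and> successively (\<lambda>u v. {u, v} \<in> E) p"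

definition path_from_to :: "'v set \<Rightarrow> 'v set set \<Rightarrow> 'v \<Rightarrow> 'v list \<Rightarrow> 'v \<Rightarrow> bool" where
  "path_from_to V E u p v \<longleftrightarrow> is_path V E p \<and> hd p = u \<and> last p = v"

definition path_length :: "'v list \<Rightarrow> nat" where
  "path_length p = length p - 1"

definition path_edges :: "'v list \<Rightarrow> 'v set set" where
  "path_edges p = {{p ! i, p ! Suc i} | i. Suc i < length p}"

definition pairwise_edge_disjoint :: "'i set \<Rightarrow> ('i \<Rightarrow> 'v list) \<Rightarrow> bool" where
  "pairwise_edge_disjoint I \<pi> \<longleftrightarrow> disjoint_family_on (\<lambda>i. path_edges (\<pi> i)) I"

end

theory Submission
  imports Defs
begin

text \<open>
  Say that a target touches \<open>v \<in> U\<close> if it is the node \<open>v\<close> or a block \<open>V \<noteq> U\<close> through \<open>v\<close>; a target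
  touches at most one \<open>v\<close>. For every touched \<open>v\<close> one target touching it (the node \<open>v\<close> itself if
  possible) is reached directly through \<open>v\<close>. The remaining targets are injectively assigned to
  start nodes in the set \<open>R\<close> of untouched nodes of \<open>U\<close>. From \<open>r \<in> R\<close> a path continues through the
  block joining \<open>r\<close> to some node \<open>x \<notin> U\<close> of another group. These blocks meet \<open>U\<close> only in \<open>r\<close>, so
  they are distinct for distinct \<open>r\<close> and none of them is a target of one of the other paths. If
  the target is a node outside \<open>U\<close>, then \<open>x\<close> is this node. If it is a block \<open>W\<close>, then \<open>x\<close> is the
  node of \<open>W\<close> in the group of \<open>f r\<close>, where \<open>f\<close> is a derangement of \<open>U - W\<close> depending only on \<open>W\<close>;
  thus the last edges are distinct. A further path to a node \<open>y \<in> U\<close> is routed to its own block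
  \<open>W\<close> through \<open>y\<close> and then to \<open>y\<close>.

  The scheme fails in two cases only: if all remaining targets are nodes in the group of a single
  \<open>r \<in> R\<close>, or if \<open>\<Delta> = 2\<close> and \<open>U - W\<close> is a singleton. Then one path makes a detour from \<open>r\<close> over a
  suitable node \<open>z\<close> of another group; as \<open>\<Delta> \<le> k\<close>, this group has a node avoiding the other paths.
\<close>

section \<open>Derangements, injective assignments and edge sets of paths\<close>

text \<open>A cyclic shift along an enumeration of \<open>S\<close> moves every element once there
  are at least two.\<close>

lemma ex_derangement:
  assumes "finite S" "2 \<le> card S"
  shows "\<exists>f. inj_on f S \<and> f ` S \<subseteq> S \<and> (\<forall>x\<in>S. f x \<noteq> x)"
proof -
  define n where "n = card S"
  obtain h where h: "bij_betw h S {0..<n}"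
    using ex_bij_betw_finite_nat[OF assms(1)] n_def by blast
  have n: "2 \<le> n" using assms n_def by simp
  define c where "c m = Suc m mod n" for m
  have cr: "c m < n" for m using n by (simp add: c_def)
  have ci: "inj_on c {0..<n}"
    by (rule inj_onI) (use n in \<open>auto simp: c_def mod_Suc split: if_splits\<close>)
  have cn: "c m \<noteq> m" if "m < n" for m
    using n that by (auto simp: c_def mod_Suc)
  define g where "g = inv_into S h"
  have g: "bij_betw g {0..<n} S" using h bij_betw_inv_into g_def by blast
  have hg: "h (g m) = m" if "m < n" for m
    using h that by (simp add: g_def bij_betw_inv_into_right)
  have hS: "h x < n" if "x \<in> S" for x using h that by (auto dest: bij_betwE)
  have "inj_on (g \<circ> c \<circ> h) S"
  proof (rule inj_onI)
    fix x y assume xy: "x \<in> S" "y \<in> S" "(g \<circ> c \<circ> h) x = (g \<circ> c \<circ> h) y"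
    then have "c (h x) = c (h y)" using hg cr by (metis comp_apply)
    then have "h x = h y" using ci hS xy by (auto dest: inj_onD)
    then show "x = y" using h xy by (auto simp: bij_betw_def dest: inj_onD)
  qed
  moreover have "(g \<circ> c \<circ> h) ` S \<subseteq> S" using g cr by (auto dest: bij_betwE)
  moreover have "(g \<circ> c \<circ> h) x \<noteq> x" if "x \<in> S" for x
    using hg[OF cr, of "h x"] cn[OF hS[OF that]] by auto
  ultimately show ?thesis by blast
qed

text \<open>Take an injection with the fewest bad values. If the bad value of \<open>q0\<close> is
  not bad for some \<open>q1\<close>, swapping their values lowers the count, since
  \<open>uniq\<close> makes the new value of \<open>q0\<close> good. So a remaining bad value is bad
  for every element of \<open>Q\<close>.\<close>

lemma ex_inj_avoiding:
  assumes "finite Q" "finite R" "card Q \<le> card R"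
    and uniq: "\<And>q u v. q \<in> Q \<Longrightarrow> u \<in> R \<Longrightarrow> v \<in> R \<Longrightarrow> bad q u \<Longrightarrow> bad q v \<Longrightarrow> u = v"
  shows "\<exists>\<sigma>. inj_on \<sigma> Q \<and> \<sigma> ` Q \<subseteq> R \<and>
           ((\<forall>q\<in>Q. \<not> bad q (\<sigma> q)) \<or> (\<exists>q0\<in>Q. \<forall>q\<in>Q. bad q (\<sigma> q0)))"
proof -
  define ok where "ok \<sigma> \<longleftrightarrow> inj_on \<sigma> Q \<and> \<sigma> ` Q \<subseteq> R" for \<sigma>
  define cnt where "cnt \<sigma> = card {q\<in>Q. bad q (\<sigma> q)}" for \<sigma>
  obtain \<sigma>0 where "ok \<sigma>0"
    using card_le_inj[OF assms(1-3)] unfolding ok_def by blast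
  then obtain \<sigma> where ok: "ok \<sigma>" and min: "\<And>\<tau>. ok \<tau> \<Longrightarrow> cnt \<sigma> \<le> cnt \<tau>"
    using ex_has_least_nat[of ok \<sigma>0 cnt] by blast
  have inj: "inj_on \<sigma> Q" and ran: "\<sigma> ` Q \<subseteq> R" using ok by (auto simp: ok_def)
  have "\<forall>q\<in>Q. bad q (\<sigma> q0)" if q0: "q0 \<in> Q" "bad q0 (\<sigma> q0)" for q0
  proof (rule ccontr)
    assume "\<not> (\<forall>q\<in>Q. bad q (\<sigma> q0))"
    then obtain q1 where q1: "q1 \<in> Q" "\<not> bad q1 (\<sigma> q0)" by blast
    define \<tau> where "\<tau> = \<sigma>(q0 := \<sigma> q1, q1 := \<sigma> q0)"
    have ne: "q1 \<noteq> q0" using q0 q1 by auto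
    then have "\<sigma> q1 \<noteq> \<sigma> q0" using inj q0 q1 by (auto dest: inj_onD)
    then have nb: "\<not> bad q0 (\<sigma> q1)" using uniq[of q0 "\<sigma> q0" "\<sigma> q1"] q0 q1 ran by auto
    have "ok \<tau>"
      using inj ran q0 q1 ne unfolding ok_def \<tau>_def inj_on_def by (auto split: if_splits)
    moreover have "{q\<in>Q. bad q (\<tau> q)} \<subset> {q\<in>Q. bad q (\<sigma> q)}"
      using q0 q1 nb ne by (auto simp: \<tau>_def split: if_splits)
    then have "cnt \<tau> < cnt \<sigma>" unfolding cnt_def using assms(1) by (intro psubset_card_mono) auto
    ultimately show False using min by force
  qed
  then show ?thesis using inj ran by blast
qed

lemma path_edges_simps [simp]:
  "path_edges [] = {}" "path_edges [a] = {}"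
  "path_edges (a # b # l) = insert {a, b} (path_edges (b # l))"
proof -
  show "path_edges (a # b # l) = insert {a, b} (path_edges (b # l))"
    unfolding path_edges_def
    by (auto simp: less_Suc_eq_0_disj) (metis nth_Cons_0 nth_Cons_Suc)+
qed (auto simp: path_edges_def)

lemma Block_Node_swap: "{Block b, Node x} = {Node x, Block b}"
  by auto

section \<open>Groups, blocks and joining blocks of a transversal design\<close>

locale transversal =
  fixes \<Delta> k :: nat and X :: "'a set" and G B :: "'a set set"
  assumes td: "transversal_design \<Delta> k X G B"
begin

lemma design:
  "2 \<le> \<Delta>" "2 \<le> k" "finite X" "partition_on X G" "card G = \<Delta>"
  "\<forall>g\<in>G. card g = k"
  "\<forall>b\<in>B. b \<subseteq> X \<and> card b = \<Delta> \<and> (\<forall>g\<in>G. \<exists>!x. x \<in> b \<inter> g)"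
  "\<forall>g\<in>G. \<forall>h\<in>G. g \<noteq> h \<longrightarrow> (\<forall>x\<in>g. \<forall>y\<in>h. \<exists>!b. b \<in> B \<and> x \<in> b \<and> y \<in> b)"
  using td unfolding transversal_design_def by - (elim conjE, assumption)+

definition grp :: "'a \<Rightarrow> 'a set" where
  "grp x = (THE g. g \<in> G \<and> x \<in> g)"

definition pt :: "'a set \<Rightarrow> 'a set \<Rightarrow> 'a" where
  "pt b g = (THE x. x \<in> b \<inter> g)"

definition join :: "'a \<Rightarrow> 'a \<Rightarrow> 'a set" where
  "join x y = (THE b. b \<in> B \<and> x \<in> b \<and> y \<in> b)"

lemma grp_eq: "g \<in> G \<Longrightarrow> x \<in> g \<Longrightarrow> grp x = g"
  using design(4) unfolding grp_def partition_on_def disjoint_def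
  by (intro the_equality) auto

lemma grp_mem: "x \<in> X \<Longrightarrow> grp x \<in> G \<and> x \<in> grp x"
  using design(4) grp_eq unfolding partition_on_def by auto

lemma group_subset: "g \<in> G \<Longrightarrow> g \<subseteq> X"
  using design(4) unfolding partition_on_def by auto

lemma card_group: "g \<in> G \<Longrightarrow> card g = k"
  using bspec[OF design(6)] by simp

lemma block_subset: "b \<in> B \<Longrightarrow> b \<subseteq> X"
  using bspec[OF design(7), THEN conjunct1] .

lemma block_card: "b \<in> B \<Longrightarrow> finite b \<and> card b = \<Delta>"
  using bspec[OF design(7), THEN conjunct2, THEN conjunct1] finite_subset[OF block_subset design(3)]
  by simp

lemma block_meets: "b \<in> B \<Longrightarrow> g \<in> G \<Longrightarrow> \<exists>!x. x \<in> b \<inter> g"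
  using bspec[OF bspec[OF design(7), THEN conjunct2, THEN conjunct2]] .

lemma pt: "b \<in> B \<Longrightarrow> g \<in> G \<Longrightarrow> pt b g \<in> b \<and> pt b g \<in> g \<and> grp (pt b g) = g"
  using theI'[OF block_meets, of b g] grp_eq unfolding pt_def by auto

lemma block_grp_inj: "b \<in> B \<Longrightarrow> x \<in> b \<Longrightarrow> y \<in> b \<Longrightarrow> grp x = grp y \<Longrightarrow> x = y"
  using block_meets[of b "grp x"] grp_mem[of x] grp_mem[of y] block_subset[of b] by auto

lemma pt_eq: "b \<in> B \<Longrightarrow> x \<in> b \<Longrightarrow> pt b (grp x) = x"
  using pt[of b "grp x"] block_grp_inj[of b "pt b (grp x)" x] grp_mem[of x] block_subset[of b]
  by auto

lemma join_unique:
  "x \<in> X \<Longrightarrow> y \<in> X \<Longrightarrow> grp x \<noteq> grp y \<Longrightarrow> \<exists>!b. b \<in> B \<and> x \<in> b \<and> y \<in> b"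
  using design(8)[rule_format, of "grp x" "grp y" x y] grp_mem[of x] grp_mem[of y] by simp

lemma join:
  "x \<in> X \<Longrightarrow> y \<in> X \<Longrightarrow> grp x \<noteq> grp y \<Longrightarrow> join x y \<in> B \<and> x \<in> join x y \<and> y \<in> join x y"
  using theI'[OF join_unique, of x y] unfolding join_def by auto

text \<open>A block meets each group once, so two distinct points of it lie in distinct groups, and
  only one block joins such points.\<close>

lemma block_eqI:
  assumes "b \<in> B" "c \<in> B" "x \<in> b" "y \<in> b" "x \<in> c" "y \<in> c" "x \<noteq> y"
  shows "b = c"
proof -
  have g: "grp x \<noteq> grp y" using block_grp_inj[OF assms(1,3,4)] assms(7) by blast
  have "x \<in> X" "y \<in> X" using block_subset[OF assms(1)] assms(3,4) by auto
  then obtain a where "\<And>b'. b' \<in> B \<and> x \<in> b' \<and> y \<in> b' \<Longrightarrow> b' = a"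
    using join_unique[OF _ _ g] by metis
  then show ?thesis using assms(1-6) by metis
qed

lemma ex_other_group: "g \<in> G \<Longrightarrow> \<exists>h\<in>G. h \<noteq> g"
proof (rule ccontr)
  assume "g \<in> G" "\<not> (\<exists>h\<in>G. h \<noteq> g)"
  then have "G = {g}" by blast
  then have "card G = 1" by simp
  then show False using design(1,5) by simp
qed

text \<open>A block through \<open>x\<close> is determined by its point in a fixed group
  \<open>h\<close> not containing \<open>x\<close>, and each of the \<open>k\<close> points of
  \<open>h\<close> arises in this way.\<close>

lemma degree:
  assumes "x \<in> X" shows "finite {b\<in>B. x \<in> b} \<and> card {b\<in>B. x \<in> b} = k"
proof -
  obtain h where h: "h \<in> G" "h \<noteq> grp x" using ex_other_group[of "grp x"] grp_mem[OF assms] by blast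
  have fh: "finite h" using finite_subset[OF group_subset[OF h(1)] design(3)] .
  have gh: "grp y \<noteq> grp x" "y \<in> X" if "y \<in> h" for y
    using grp_eq[OF h(1) that] h(2) group_subset[OF h(1)] that by auto
  have bij: "bij_betw (\<lambda>b. pt b h) {b\<in>B. x \<in> b} h"
  proof (rule bij_betw_byWitness[where f' = "join x"])
    show "\<forall>b\<in>{b\<in>B. x \<in> b}. join x (pt b h) = b"
    proof clarify
      fix b assume b: "b \<in> B" "x \<in> b"
      have p: "pt b h \<in> b" "pt b h \<in> h" using pt[OF b(1) h(1)] by auto
      then show "join x (pt b h) = b"
        using join[OF assms gh(2)[OF p(2)]] gh[OF p(2)] b
        by (intro block_eqI[of _ _ x "pt b h"]) auto
    qed
    show "\<forall>y\<in>h. pt (join x y) h = y"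
      using join[OF assms gh(2)] gh pt_eq grp_eq[OF h(1)] by metis
    show "(\<lambda>b. pt b h) ` {b\<in>B. x \<in> b} \<subseteq> h" using pt[OF _ h(1)] by auto
    show "join x ` h \<subseteq> {b\<in>B. x \<in> b}" using join[OF assms gh(2)] gh by fastforce
  qed
  show ?thesis using bij_betw_finite[OF bij] bij_betw_same_card[OF bij] fh card_group[OF h(1)] by simp
qed

section \<open>The incidence graph and the blocks that meet \<open>U\<close> in one start
  node\<close>

lemma edge_iff: "b \<in> B \<Longrightarrow> {Node x, Block b} \<in> edges X B \<longleftrightarrow> x \<in> b"
  "b \<in> B \<Longrightarrow> {Block b, Node x} \<in> edges X B \<longleftrightarrow> x \<in> b"
  using block_subset by (auto simp: edges_def doubleton_eq_iff)

lemma vertex_iff [simp]: "Node x \<in> vertices X B \<longleftrightarrow> x \<in> X" "Block b \<in> vertices X B \<longleftrightarrow> b \<in> B"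
  by (auto simp: vertices_def)

text \<open>A second common point with \<open>U\<close> would force \<open>join r x = U\<close> by
  \<open>block_eqI\<close>, against \<open>x \<notin> U\<close>. Hence joining blocks with different
  start nodes are different.\<close>

lemma join_meets_block:
  assumes "U \<in> B" "r \<in> U" "x \<in> X" "x \<notin> U" "grp x \<noteq> grp r"
  shows "join r x \<in> B" "r \<in> join r x" "x \<in> join r x" "join r x \<noteq> U"
    "\<And>v. v \<in> join r x \<Longrightarrow> v \<in> U \<Longrightarrow> v = r"
proof -
  have r: "r \<in> X" using assms block_subset by blast
  show 1: "join r x \<in> B" "r \<in> join r x" "x \<in> join r x" using join[OF r assms(3)] assms by auto
  show 2: "join r x \<noteq> U" using 1 assms by auto
  show "v = r" if "v \<in> join r x" "v \<in> U" for v
    using block_eqI[of "join r x" U v r] 1 2 that assms by blast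
qed

text \<open>
  Of the nodes of \<open>U\<close>, the paths may use only those in \<open>R\<close>, except that a path ending in a node
  of \<open>U\<close> enters this node by an edge that is not incident with \<open>U\<close>.
\<close>
definition routable :: "'a set \<Rightarrow> 'a set \<Rightarrow> ('i \<Rightarrow> 'a vertex) \<Rightarrow> 'i set \<Rightarrow> bool" where
  "routable U R t Q \<longleftrightarrow> (\<exists>\<pi>.
     (\<forall>i\<in>Q. path_from_to (vertices X B) (edges X B) (Block U) (\<pi> i) (t i)
             \<and> path_length (\<pi> i) \<le> 7) \<and>
     pairwise_edge_disjoint Q \<pi> \<and>
     (\<forall>i\<in>Q. \<forall>x b. {Node x, Block b} \<in> path_edges (\<pi> i) \<longrightarrow> x \<in> U \<longrightarrow>
        x \<in> R \<or> t i = Node x \<and> b \<noteq> U))"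

section \<open>Routing by direct paths\<close>

text \<open>Each path is \<open>U, \<sigma> i, b i, x i\<close> followed by \<open>tail i\<close>,
  so it has at most five edges. The blocks \<open>b i\<close> are distinct and meet
  \<open>R\<close>, while the final blocks \<open>W i\<close> avoid \<open>R\<close>. So two paths
  could share an edge only at a common \<open>W i\<close>; \<open>entry\<close> excludes this for
  the edges at \<open>x i\<close>, and \<open>exit\<close> for those at a final node of
  \<open>U\<close>.\<close>

lemma routable_direct:
  assumes U: "U \<in> B" and R: "R \<subseteq> U" and inj: "inj_on \<sigma> Q" and ran: "\<sigma> ` Q \<subseteq> R"
    and x: "\<And>i. i \<in> Q \<Longrightarrow> x i \<in> X \<and> x i \<notin> U \<and> grp (x i) \<noteq> grp (\<sigma> i)"
    and tail: "\<And>i. i \<in> Q \<Longrightarrow> (tail i = [] \<and> t i = Node (x i)) \<or>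
        (W i \<in> B \<and> W i \<inter> R = {} \<and> W i \<noteq> U \<and> x i \<in> W i \<and>
          (t i = Block (W i) \<and> tail i = [Block (W i)] \<or>
           (\<exists>y\<in>U. y \<in> W i \<and> t i = Node y \<and> tail i = [Block (W i), Node y])))"
    and entry: "\<And>i j. i \<in> Q \<Longrightarrow> j \<in> Q \<Longrightarrow> i \<noteq> j \<Longrightarrow> tail i \<noteq> [] \<Longrightarrow> tail j \<noteq> [] \<Longrightarrow> W i = W j \<Longrightarrow> x i \<noteq> x j"
    and exit: "\<And>i j y. i \<in> Q \<Longrightarrow> j \<in> Q \<Longrightarrow> i \<noteq> j \<Longrightarrow> y \<in> U \<Longrightarrow> t i = Node y \<Longrightarrow> t j = Node y \<Longrightarrow> W i \<noteq> W j"
  shows "routable U R t Q"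
proof -
  define b where "b i = join (\<sigma> i) (x i)" for i
  define \<pi> where "\<pi> i = Block U # Node (\<sigma> i) # Block (b i) # Node (x i) # tail i" for i
  have s: "\<sigma> i \<in> R" "\<sigma> i \<in> U" "\<sigma> i \<in> X" if "i \<in> Q" for i
    using that ran R block_subset[OF U] by auto
  have b: "b i \<in> B" "\<sigma> i \<in> b i" "x i \<in> b i" "b i \<noteq> U"
    "\<And>v. v \<in> b i \<Longrightarrow> v \<in> U \<Longrightarrow> v = \<sigma> i" if "i \<in> Q" for i
    using join_meets_block[OF U, of "\<sigma> i" "x i"] x[OF that] s[OF that] by (auto simp: b_def)
  have path: "path_from_to (vertices X B) (edges X B) (Block U) (\<pi> i) (t i) \<and> path_length (\<pi> i) \<le> 7"
    if i: "i \<in> Q" for i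
  proof -
    have ne: "x i \<noteq> \<sigma> i" "\<sigma> i \<noteq> x i" "U \<noteq> b i" using x[OF i] b(4)[OF i] by auto
    note facts = ne x[OF i] s[OF i] b(1-4)[OF i] U
    note simps = \<pi>_def path_from_to_def is_path_def path_length_def edge_iff
    from tail[OF i] consider "tail i = []" "t i = Node (x i)"
      | "W i \<in> B" "W i \<inter> R = {}" "W i \<noteq> U" "x i \<in> W i" "t i = Block (W i)" "tail i = [Block (W i)]"
      | y where "W i \<in> B" "W i \<inter> R = {}" "W i \<noteq> U" "x i \<in> W i" "y \<in> U" "y \<in> W i"
        "t i = Node y" "tail i = [Block (W i), Node y]"
      by blast
    then show ?thesis
    proof cases
      case 1
      then show ?thesis using facts by (simp add: simps)
    next
      case 2
      then have "b i \<noteq> W i" "U \<noteq> W i" using b(2)[OF i] s(1)[OF i] by auto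
      then show ?thesis using 2 facts by (simp add: simps)
    next
      case 3
      then have "b i \<noteq> W i" "U \<noteq> W i" "y \<in> X" "\<sigma> i \<noteq> y" "x i \<noteq> y"
        using b(2)[OF i] s(1)[OF i] x[OF i] block_subset[OF U] by auto
      then show ?thesis using 3 facts by (simp add: simps)
    qed
  qed
  \<comment> \<open>\<open>e\<close> describes an edge by its node and its block, so that
    disjointness need not be argued with unordered pairs. It only bounds the edges from above; the
    last disjunct covers both possible edges at \<open>W i\<close>.\<close>
  define e where "e i x' b' \<longleftrightarrow> x' = \<sigma> i \<and> b' = U \<or> x' = \<sigma> i \<and> b' = b i \<or> x' = x i \<and> b' = b i \<or>
      tail i \<noteq> [] \<and> W i \<inter> R = {} \<and> b' = W i \<and> b' \<noteq> U \<and> (x' = x i \<or> x' \<in> U \<and> t i = Node x')" for i x' b'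
  have edge: "\<exists>x' b'. f = {Node x', Block b'} \<and> e i x' b'" if i: "i \<in> Q" and f: "f \<in> path_edges (\<pi> i)" for i f
  proof -
    note f' = f[unfolded \<pi>_def]
    have e: "e i (\<sigma> i) U" "e i (\<sigma> i) (b i)" "e i (x i) (b i)" by (simp_all add: e_def)
    from tail[OF i] show ?thesis
    proof (elim disjE conjE bexE)
      assume "tail i = []"
      then have "f \<in> {{Node (\<sigma> i), Block U}, {Node (\<sigma> i), Block (b i)}, {Node (x i), Block (b i)}}"
        using f' by (simp add: Block_Node_swap)
      then show ?thesis using e by blast
    next
      assume *: "W i \<inter> R = {}" "W i \<noteq> U" "tail i = [Block (W i)]"
      then have "f \<in> {{Node (\<sigma> i), Block U}, {Node (\<sigma> i), Block (b i)}, {Node (x i), Block (b i)},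
          {Node (x i), Block (W i)}}" using f' by (simp add: Block_Node_swap)
      moreover have "e i (x i) (W i)" using * by (simp add: e_def)
      ultimately show ?thesis using e by blast
    next
      fix y assume *: "W i \<inter> R = {}" "W i \<noteq> U" "y \<in> U" "t i = Node y" "tail i = [Block (W i), Node y]"
      then have "f \<in> {{Node (\<sigma> i), Block U}, {Node (\<sigma> i), Block (b i)}, {Node (x i), Block (b i)},
          {Node (x i), Block (W i)}, {Node y, Block (W i)}}" using f' by (simp add: Block_Node_swap)
      moreover have "e i (x i) (W i)" "e i y (W i)" using * by (simp_all add: e_def)
      ultimately show ?thesis using e by blast
    qed
  qed
  have "False" if i: "i \<in> Q" and j: "j \<in> Q" and ij: "i \<noteq> j" and e: "e i x' b'" "e j x' b'" for i j x' b'
  proof -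
    have "\<sigma> i \<noteq> \<sigma> j" using inj i j ij by (auto dest: inj_onD)
    \<comment> \<open>\<open>\<sigma> i\<close> lies in \<open>b i\<close>, but the only node of
      \<open>U\<close> on \<open>b j\<close> is \<open>\<sigma> j\<close>.\<close>
    moreover have "b i \<noteq> b j"
      using b(2)[OF i] b(5)[OF j, of "\<sigma> i"] s(2)[OF i] \<open>\<sigma> i \<noteq> \<sigma> j\<close> by metis
    moreover have "W l \<inter> R = {} \<Longrightarrow> b i \<noteq> W l" "W l \<inter> R = {} \<Longrightarrow> b j \<noteq> W l" for l
      using b(2)[OF i] s(1)[OF i] b(2)[OF j] s(1)[OF j] by blast+
    moreover note b(4)[OF i] b(4)[OF j] x[OF i] x[OF j] s(2)[OF i] s(2)[OF j]
      entry[OF i j ij] exit[OF i j ij]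
    ultimately show False using e unfolding e_def by metis
  qed
  then have disj: "path_edges (\<pi> i) \<inter> path_edges (\<pi> j) = {}"
    if "i \<in> Q" "j \<in> Q" "i \<noteq> j" for i j
    using edge[OF that(1)] edge[OF that(2)] that by (fastforce simp: doubleton_eq_iff)
  have touch: "x' \<in> R \<or> t i = Node x' \<and> b' \<noteq> U"
    if i: "i \<in> Q" and f: "{Node x', Block b'} \<in> path_edges (\<pi> i)" "x' \<in> U" for i x' b'
  proof -
    have "e i x' b'" using edge[OF i f(1)] by (auto simp: doubleton_eq_iff)
    then show ?thesis using f(2) s(1)[OF i] x[OF i] unfolding e_def by metis
  qed
  show ?thesis unfolding routable_def pairwise_edge_disjoint_def disjoint_family_on_def
    using path disj touch by blast
qed

section \<open>Routing with one detour\<close>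

text \<open>All \<open>x i\<close> lie in the group of \<open>\<sigma> q\<close>, so
  \<open>q\<close> is the only index for which no block joins \<open>\<sigma> i\<close> to
  \<open>x i\<close>. Its path is \<open>U, r, b, z, d, x q\<close> followed by \<open>tail\<close>;
  a tail of two vertices gives exactly seven edges. The other paths go directly through blocks
  \<open>c i\<close>, and \<open>z\<close> is a node of \<open>h\<close> outside \<open>U\<close>
  and outside all these blocks.\<close>

lemma routable_detour:
  assumes U: "U \<in> B" and R: "R \<subseteq> U" and inj: "inj_on \<sigma> Q" and ran: "\<sigma> ` Q \<subseteq> R"
    and le: "\<Delta> \<le> k" and q: "q \<in> Q" and h: "h \<in> G" "h \<noteq> grp (\<sigma> q)"
    and x: "\<And>i. i \<in> Q \<Longrightarrow> x i \<in> X \<and> x i \<notin> U \<and> grp (x i) = grp (\<sigma> q)"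
    and t: "\<And>i. i \<in> Q \<Longrightarrow> i \<noteq> q \<Longrightarrow> t i = Node (x i)"
    and tail: "(tail = [] \<and> t q = Node (x q)) \<or>
        (Q = {q} \<and> W \<in> B \<and> W \<inter> R = {} \<and> W \<noteq> U \<and> x q \<in> W \<and> pt U h \<in> W \<and>
          (t q = Block W \<and> tail = [Block W] \<or>
           t q = Node (pt U h) \<and> tail = [Block W, Node (pt U h)]))"
  shows "routable U R t Q"
proof -
  define r where "r = \<sigma> q"
  define Q' where "Q' = Q - {q}"
  define u where "u = pt U h"
  have u: "u \<in> U" "u \<in> h" "grp u = h" using pt U h by (auto simp: u_def)
  have fU: "finite U" "card U = \<Delta>" using block_card U by auto
  have s: "\<sigma> i \<in> R" "\<sigma> i \<in> U" "\<sigma> i \<in> X" if "i \<in> Q" for i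
    using that ran R block_subset[OF U] by auto
  have r: "r \<in> R" "r \<in> U" "r \<in> X" using s q by (auto simp: r_def)
  have ur: "u \<noteq> r" using u h r_def by auto
  \<comment> \<open>For \<open>i = q\<close> the two nodes share a group and \<open>c q\<close> is
    arbitrary; the facts about \<open>c\<close> are therefore restricted to
    \<open>Q'\<close>.\<close>
  define c where "c i = join (\<sigma> i) (x i)" for i
  have sr: "\<sigma> i \<noteq> r" if "i \<in> Q'" for i
    using inj that q by (auto simp: Q'_def r_def dest: inj_onD)
  have gr: "grp (x i) \<noteq> grp (\<sigma> i)" if "i \<in> Q'" for i
    using sr[OF that] x[of i] that r s(2)[of i] block_grp_inj[OF U] unfolding Q'_def r_def by auto
  have c: "c i \<in> B" "\<sigma> i \<in> c i" "x i \<in> c i" "c i \<noteq> U"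
    "\<And>v. v \<in> c i \<Longrightarrow> v \<in> U \<Longrightarrow> v = \<sigma> i" if "i \<in> Q'" for i
    using join_meets_block[OF U, of "\<sigma> i" "x i"] x[of i] s[of i] gr[OF that] that
    by (auto simp: c_def Q'_def)
  \<comment> \<open>\<open>Z\<close> collects the nodes of \<open>h\<close> forbidden for
    \<open>z\<close>. A block \<open>c i\<close> with \<open>\<sigma> i = u\<close> meets
    \<open>h\<close> in \<open>u\<close>, which is in \<open>Z\<close> anyway. The other
    \<open>\<sigma> i\<close> lie in \<open>U - {r, u}\<close>, so \<open>Z\<close> has at most
    \<open>\<Delta> - 1 < k\<close> nodes and cannot exhaust \<open>h\<close>.\<close>
  define Q'' where "Q'' = {i\<in>Q'. \<sigma> i \<noteq> u}"
  define Z where "Z = insert u ((\<lambda>i. pt (c i) h) ` Q'')"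
  have inj'': "inj_on \<sigma> Q''" by (rule inj_on_subset[OF inj]) (auto simp: Q''_def Q'_def)
  have sub: "\<sigma> ` Q'' \<subseteq> U - {r, u}" using s sr by (auto simp: Q''_def Q'_def)
  have fQ'': "finite Q''" using finite_imageD[OF _ inj''] finite_subset[OF sub] fU by auto
  have "card Q'' \<le> card (U - {r, u})"
    using card_inj_on_le[OF inj'' sub] fU by auto
  also have "\<dots> = \<Delta> - 2" using ur r u fU by (simp add: card_Diff_subset)
  finally have "card Z \<le> \<Delta> - 1"
    using card_image_le[OF fQ'', of "\<lambda>i. pt (c i) h"] design(1-3) fQ''
    by (auto simp: Z_def card_insert_if)
  moreover have "finite Z" using fQ'' by (simp add: Z_def)
  ultimately have "\<not> h \<subseteq> Z"
    using card_mono[of Z h] card_group[OF h(1)] design(1-3) le by auto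
  then obtain z where z: "z \<in> h" "z \<notin> Z" by blast
  have zX: "z \<in> X" "grp z = h" using z group_subset grp_eq h by auto
  have zU: "z \<notin> U" using z(2) block_grp_inj[OF U, of z u] u zX by (auto simp: Z_def)
  have zc: "z \<notin> c i" if "i \<in> Q'" for i
  proof
    assume zi: "z \<in> c i"
    then have p: "pt (c i) h = z" using pt_eq[OF c(1)[OF that], of z] zX by simp
    show False
    proof (cases "\<sigma> i = u")
      case True
      then have "u = z" using block_grp_inj[OF c(1)[OF that] c(2)[OF that] zi] zX u by simp
      then show False using zU u by simp
    next
      case False
      then show False using p z(2) that by (auto simp: Z_def Q''_def)
    qed
  qed
  have xq: "x q \<in> X" "x q \<notin> U" "grp (x q) = grp r" using x[OF q] r_def by auto
  define b where "b = join r z"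
  define d where "d = join z (x q)"
  have gzr: "grp z \<noteq> grp r" using zX(2) h(2) by (simp add: r_def)
  have gzx: "grp z \<noteq> grp (x q)" using gzr xq(3) by simp
  have b: "b \<in> B" "r \<in> b" "z \<in> b" "b \<noteq> U" "\<And>v. v \<in> b \<Longrightarrow> v \<in> U \<Longrightarrow> v = r"
    using join_meets_block[OF U r(2) zX(1) zU gzr] unfolding b_def by blast+
  have d: "d \<in> B" "z \<in> d" "x q \<in> d"
    using join[OF zX(1) xq(1) gzx] unfolding d_def by blast+
  have xr: "x q \<noteq> r" "x q \<noteq> z" using xq(2) r(2) gzx by auto
  \<comment> \<open>A block through both \<open>r\<close> and \<open>x q\<close> would meet their
    common group twice.\<close>
  have bd: "b \<noteq> d" using block_grp_inj[of b "x q" r] b(1,2) d(3) xq xr by auto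
  have dU: "d \<noteq> U" using d zU by auto
  \<comment> \<open>The node of \<open>W\<close> in \<open>h\<close> is already \<open>u\<close>, so
    \<open>W\<close> differs from \<open>b\<close> and \<open>d\<close>, which contain
    \<open>z\<close>.\<close>
  have zW: "z \<notin> W" if "W \<in> B" "pt U h \<in> W"
    using block_grp_inj[OF that(1) that(2), of z] u zX zU u_def by auto
  define \<pi> where "\<pi> i = (if i = q
      then Block U # Node r # Block b # Node z # Block d # Node (x q) # tail
      else [Block U, Node (\<sigma> i), Block (c i), Node (x i)])" for i
  have path_q: "path_from_to (vertices X B) (edges X B) (Block U) (\<pi> q) (t q) \<and> path_length (\<pi> q) \<le> 7"
  proof -
    have ne: "r \<noteq> z" "r \<noteq> x q" "z \<noteq> x q" "z \<noteq> u" "r \<noteq> u" "x q \<noteq> u" "U \<noteq> b" "U \<noteq> d" "u \<in> X"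
      using zU r xr ur u b(4) dU xq block_subset[OF U] by auto
    note facts = ne xq r b(1-3) d bd zX U
    note simps = \<pi>_def path_from_to_def is_path_def path_length_def edge_iff
    from tail[folded u_def] consider "tail = []" "t q = Node (x q)"
      | "W \<in> B" "W \<inter> R = {}" "W \<noteq> U" "x q \<in> W" "u \<in> W" "t q = Block W" "tail = [Block W]"
      | "W \<in> B" "W \<inter> R = {}" "W \<noteq> U" "x q \<in> W" "u \<in> W" "t q = Node u" "tail = [Block W, Node u]"
      by blast
    then show ?thesis
    proof cases
      case 1
      then show ?thesis using facts by (simp add: simps)
    next
      case 2
      then have "b \<noteq> W" "d \<noteq> W" "U \<noteq> W" using b(2) d(2) r(1) zW[folded u_def] by auto
      then show ?thesis using 2 facts by (simp add: simps)
    next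
      case 3
      then have "b \<noteq> W" "d \<noteq> W" "U \<noteq> W" using b(2) d(2) r(1) zW[folded u_def] by auto
      then show ?thesis using 3 facts by (simp add: simps)
    qed
  qed
  have path: "path_from_to (vertices X B) (edges X B) (Block U) (\<pi> i) (t i) \<and> path_length (\<pi> i) \<le> 7"
    if "i \<in> Q" "i \<noteq> q" for i
  proof -
    have i: "i \<in> Q'" using that Q'_def by auto
    have "x i \<noteq> \<sigma> i" "\<sigma> i \<noteq> x i" "U \<noteq> c i" using gr[OF i] c(4)[OF i] by auto
    then show ?thesis
      using t[OF that] that x[OF that(1)] s[OF that(1)] c(1-4)[OF i] U
      by (simp add: \<pi>_def path_from_to_def is_path_def path_length_def edge_iff)
  qed
  have edges_i: "path_edges (\<pi> i) =
      {{Node (\<sigma> i), Block U}, {Node (\<sigma> i), Block (c i)}, {Node (x i), Block (c i)}}"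
    if "i \<in> Q'" for i using that by (simp add: \<pi>_def Q'_def Block_Node_swap)
  have edges_q: "path_edges (\<pi> q) \<subseteq>
      {{Node r, Block U}, {Node r, Block b}, {Node z, Block b}, {Node z, Block d}, {Node (x q), Block d}} \<union>
      (if tail = [] then {} else {{Node (x q), Block W}} \<union>
        (if t q = Node u then {{Node u, Block W}} else {}))"
    using tail unfolding u_def by (elim disjE conjE) (simp_all add: \<pi>_def Block_Node_swap)
  have disj: "path_edges (\<pi> i) \<inter> path_edges (\<pi> j) = {}"
    if "i \<in> Q'" and "j \<in> Q'" and ij: "i \<noteq> j" for i j
  proof -
    have i: "i \<in> Q" and j: "j \<in> Q" using that by (auto simp: Q'_def)
    have ne: "\<sigma> i \<noteq> \<sigma> j" using inj i j ij by (auto dest: inj_onD)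
    have "c i \<noteq> c j" using c(2)[OF that(1)] c(5)[OF that(2), of "\<sigma> i"] s(2)[OF i] ne by metis
    then show ?thesis unfolding edges_i[OF that(1)] edges_i[OF that(2)]
      using c(4)[OF that(1)] c(4)[OF that(2)] ne by (simp add: doubleton_eq_iff)
  qed
  have disj_q: "path_edges (\<pi> i) \<inter> path_edges (\<pi> q) = {}" if "i \<in> Q'" for i
  proof -
    have i: "i \<in> Q" "i \<noteq> q" using that by (auto simp: Q'_def)
    \<comment> \<open>A nonempty tail would require \<open>Q = {q}\<close>, but \<open>i\<close> is
      a second index.\<close>
    have "tail = []" using tail i q by blast
    then have "path_edges (\<pi> q) \<subseteq>
      {{Node r, Block U}, {Node r, Block b}, {Node z, Block b}, {Node z, Block d}, {Node (x q), Block d}}"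
      using edges_q by simp
    moreover have "c i \<noteq> b" "c i \<noteq> d" using zc[OF that] b(3) d(2) by metis+
    then have "path_edges (\<pi> i) \<inter>
      {{Node r, Block U}, {Node r, Block b}, {Node z, Block b}, {Node z, Block d}, {Node (x q), Block d}} = {}"
      unfolding edges_i[OF that] using c(4)[OF that] b(4) dU sr[OF that]
      by (simp add: doubleton_eq_iff)
    ultimately show ?thesis by blast
  qed
  have touch_q: "x' \<in> R \<or> t q = Node x' \<and> b' \<noteq> U"
    if "{Node x', Block b'} \<in> path_edges (\<pi> q)" "x' \<in> U" for x' b'
  proof -
    have "W \<noteq> U" if "tail \<noteq> []" using tail that by blast
    moreover have "x' = r \<or> x' = z \<or> x' = x q \<or> tail \<noteq> [] \<and> t q = Node x' \<and> b' = W"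
      using subsetD[OF edges_q that(1)] by (auto simp: doubleton_eq_iff split: if_splits)
    ultimately show ?thesis using that(2) r(1) zU xq(2) by metis
  qed
  have touch: "x' \<in> R \<or> t i = Node x' \<and> b' \<noteq> U"
    if "i \<in> Q" "i \<noteq> q" "{Node x', Block b'} \<in> path_edges (\<pi> i)" "x' \<in> U" for i x' b'
  proof -
    have "i \<in> Q'" using that by (simp add: Q'_def)
    then have "x' = \<sigma> i \<or> x' = x i" using that(3) by (auto simp: edges_i doubleton_eq_iff)
    then show ?thesis using that(4) x[OF that(1)] s(1)[OF that(1)] by metis
  qed
  have "\<forall>i\<in>Q. path_from_to (vertices X B) (edges X B) (Block U) (\<pi> i) (t i) \<and> path_length (\<pi> i) \<le> 7"
    using path path_q by blast
  moreover have "pairwise_edge_disjoint Q \<pi>"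
    unfolding pairwise_edge_disjoint_def disjoint_family_on_def
  proof (intro ballI impI)
    fix i j assume "i \<in> Q" "j \<in> Q" "i \<noteq> j"
    then consider "i \<in> Q'" "j \<in> Q'" | "i = q" "j \<in> Q'" | "i \<in> Q'" "j = q" by (auto simp: Q'_def)
    then show "path_edges (\<pi> i) \<inter> path_edges (\<pi> j) = {}"
      by cases (use disj disj_q \<open>i \<noteq> j\<close> in \<open>auto simp: Int_commute\<close>)
  qed
  ultimately show ?thesis unfolding routable_def using touch touch_q by blast
qed

section \<open>Choosing the routes of the remaining targets\<close>

lemma block_inter_eq: "b \<in> B \<Longrightarrow> c \<in> B \<Longrightarrow> b \<noteq> c \<Longrightarrow> x \<in> b \<Longrightarrow> x \<in> c \<Longrightarrow> b \<inter> c = {x}"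
  using block_eqI by blast

text \<open>Each target in \<open>U\<close> is traded for a block through it; by \<open>tn\<close>
  and \<open>tb\<close> all final blocks then avoid the start nodes in \<open>R\<close>. Start nodes
  come from \<open>ex_inj_avoiding\<close>, entry nodes of final blocks from derangements, and
  \<open>routable_detour\<close> covers the two exceptions.\<close>

lemma routable_if_card_le:
  assumes U: "U \<in> B" and R: "R \<subseteq> U" and le: "\<Delta> \<le> k" and Q: "finite Q" "card Q \<le> card R"
    and tv: "\<And>i. i \<in> Q \<Longrightarrow> t i \<in> vertices X B \<and> t i \<noteq> Block U"
    and tn: "\<And>i y. i \<in> Q \<Longrightarrow> t i = Node y \<Longrightarrow> y \<notin> R"
    and tb: "\<And>i V. i \<in> Q \<Longrightarrow> t i = Block V \<Longrightarrow> V \<inter> R = {}"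
  shows "routable U R t Q"
proof -
  have fU: "finite U" "card U = \<Delta>" using block_card U by auto
  have fR: "finite R" using R fU finite_subset by auto
  have UX: "U \<subseteq> X" using U block_subset by auto
  define E where "E y = {i\<in>Q. t i = Node y}" for y
  \<comment> \<open>Targets equal to the same \<open>y \<in> U\<close> need distinct blocks through
    \<open>y\<close> other than \<open>U\<close>. There are \<open>k - 1\<close> of these; if such a
    target exists then \<open>y \<notin> R\<close>, so there are at most
    \<open>card R \<le> \<Delta> - 1\<close> targets.\<close>
  have "\<forall>y\<in>U. \<exists>w. inj_on w (E y) \<and> w ` E y \<subseteq> {b\<in>B. y \<in> b} - {U}"
  proof
    fix y assume y: "y \<in> U"
    show "\<exists>w. inj_on w (E y) \<and> w ` E y \<subseteq> {b\<in>B. y \<in> b} - {U}"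
    proof (cases "E y = {}")
      case False
      then have "y \<notin> R" using tn by (auto simp: E_def)
      then have "R \<subset> U" using y R by auto
      then have "card R < \<Delta>" using fU psubset_card_mono by blast
      moreover have "card (E y) \<le> card Q" using Q by (auto simp: E_def intro: card_mono)
      moreover have "card ({b\<in>B. y \<in> b} - {U}) = k - 1"
        using degree[of y] y U UX by (subst card_Diff_singleton) auto
      ultimately have "card (E y) \<le> card ({b\<in>B. y \<in> b} - {U})" using Q le by linarith
      then show ?thesis
        using card_le_inj[of "E y" "{b\<in>B. y \<in> b} - {U}"] degree[of y] y UX Q
        by (auto simp: E_def)
    qed auto
  qed
  then obtain w where w: "\<And>y. y \<in> U \<Longrightarrow> inj_on (w y) (E y)"
    "\<And>y. y \<in> U \<Longrightarrow> w y ` E y \<subseteq> {b\<in>B. y \<in> b} - {U}"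
    by metis
  \<comment> \<open>The last block on the path to a block or to a node of \<open>U\<close>. For a
    node outside \<open>U\<close> the value is arbitrary, and \<open>tail i\<close> is
    empty.\<close>
  define W where "W i = (case t i of Block V \<Rightarrow> V | Node y \<Rightarrow> w y i)" for i
  define out where "out i \<longleftrightarrow> (\<exists>y. t i = Node y \<and> y \<notin> U)" for i
  define tail where "tail i = (if out i then [] else
    case t i of Block V \<Rightarrow> [Block V] | Node y \<Rightarrow> [Block (W i), Node y])" for i
  have Wy: "W i \<in> B \<and> W i \<noteq> U \<and> y \<in> W i" if "i \<in> Q" "y \<in> U" "t i = Node y" for i y
    using w(2)[OF that(2)] that by (auto simp: W_def E_def)
  have W: "W i \<in> B" "W i \<noteq> U" "W i \<inter> R = {}" if i: "i \<in> Q" "\<not> out i" for i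
  proof -
    show "W i \<in> B" "W i \<noteq> U" "W i \<inter> R = {}"
    proof (atomize (full), cases "t i")
      case (Node y)
      then have y: "y \<in> U" using i by (auto simp: out_def)
      then have "W i \<inter> U = {y}" using block_inter_eq[of "W i" U y] Wy i Node U by auto
      then show "W i \<in> B \<and> W i \<noteq> U \<and> W i \<inter> R = {}" using Wy[OF i(1) y Node] tn[OF i(1) Node] R by auto
    next
      case (Block V)
      then show "W i \<in> B \<and> W i \<noteq> U \<and> W i \<inter> R = {}" using tv[OF i(1)] tb[OF i(1)] by (auto simp: W_def)
    qed
  qed
  show ?thesis
  proof (cases "\<exists>q\<in>Q. \<not> out q \<and> card (U - W q) < 2")
    \<comment> \<open>Here \<open>U - W q\<close> is too small for a derangement. As it contains
      \<open>R\<close>, and \<open>q \<in> Q\<close>, both \<open>R\<close> and \<open>Q\<close> are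
      singletons.\<close>
    case True
    then obtain q where q: "q \<in> Q" "\<not> out q" "card (U - W q) < 2" by blast
    note Wq = W[OF q(1,2)]
    have Rs: "R \<subseteq> U - W q" using Wq R by auto
    then have "card R \<le> card (U - W q)" using fU card_mono by blast
    then have "card R \<le> 1" using q by auto
    moreover have "1 \<le> card Q" using q Q card_gt_0_iff[of Q] by auto
    ultimately have cRQ: "card R = 1" "card Q = 1" using Q by auto
    then obtain r where r: "R = {r}" by (auto simp: card_1_singleton_iff)
    have Qq: "Q = {q}" using cRQ q by (auto simp: card_1_singleton_iff)
    have rU: "r \<in> U" "r \<notin> W q" "r \<in> X" using r Rs UX by auto
    have "U \<inter> W q \<noteq> {}"
    proof
      assume "U \<inter> W q = {}"
      then have "U - W q = U" by auto
      then show False using q fU design(1-3) by auto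
    qed
    then obtain y where y: "y \<in> U" "y \<in> W q" by blast
    have yX: "y \<in> X" using y UX by auto
    have Uy: "U \<inter> W q = {y}" using block_inter_eq[OF U Wq(1)] Wq y by auto
    \<comment> \<open>Now \<open>\<Delta> = 2\<close>, and \<open>z\<close> is the only node of
      \<open>W q\<close> besides \<open>y\<close>. It shares its group with \<open>r\<close>, so no
      block joins the two; the detour passes through the group of \<open>y\<close>.\<close>
    define z where "z = pt (W q) (grp r)"
    have z: "z \<in> W q" "grp z = grp r" "z \<in> X"
      using pt[OF Wq(1)] grp_mem[OF rU(3)] block_subset[OF Wq(1)] by (auto simp: z_def)
    have zU: "z \<notin> U" using block_grp_inj[OF U _ rU(1), of z] z rU by auto
    have gy: "grp y \<noteq> grp r" using block_grp_inj[OF U y(1) rU(1)] rU y by auto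
    have py: "pt U (grp y) = y" using pt_eq U y by auto
    have "t q = Block (W q) \<and> tail q = [Block (W q)] \<or>
        t q = Node (pt U (grp y)) \<and> tail q = [Block (W q), Node (pt U (grp y))]"
    proof (cases "t q")
      case (Node y')
      then have "y' \<in> U" using q by (auto simp: out_def)
      then have "y' = y" using Wy[OF q(1) _ Node] Uy by auto
      then show ?thesis using Node q py by (auto simp: tail_def)
    next
      case (Block V)
      then show ?thesis using q by (auto simp: tail_def W_def)
    qed
    then show ?thesis
      using routable_detour[of U R "\<lambda>_. r" Q q "grp y" "\<lambda>_. z" t "tail q" "W q"]
        U R le q grp_mem[OF yX] gy z zU py y Wq Qq r by auto
  next
    case False
    \<comment> \<open>The derangement is chosen per block and not per path: by injectivity, paths
      with different start nodes enter the same block at different nodes.\<close>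
    have "\<exists>f. inj_on f (U - V) \<and> f ` (U - V) \<subseteq> U - V \<and> (\<forall>x\<in>U - V. f x \<noteq> x)"
      if "2 \<le> card (U - V)" for V using ex_derangement[of "U - V"] that fU by auto
    then obtain f where f: "\<And>V. 2 \<le> card (U - V) \<Longrightarrow>
        inj_on (f V) (U - V) \<and> f V ` (U - V) \<subseteq> U - V \<and> (\<forall>x\<in>U - V. f V x \<noteq> x)"
      by metis
    \<comment> \<open>For \<open>u \<in> U\<close> this says that no block joins \<open>u\<close> to
      the target node. Blocks and nodes of \<open>U\<close> are never bad targets, because their
      entry node is chosen by a derangement.\<close>
    define bad where "bad i u \<longleftrightarrow> (\<exists>y. t i = Node y \<and> y \<notin> U \<and> grp y = grp u)" for i u
    have "\<exists>\<sigma>. inj_on \<sigma> Q \<and> \<sigma> ` Q \<subseteq> R \<and>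
           ((\<forall>q\<in>Q. \<not> bad q (\<sigma> q)) \<or> (\<exists>q0\<in>Q. \<forall>q\<in>Q. bad q (\<sigma> q0)))"
    proof (rule ex_inj_avoiding[OF Q(1) fR Q(2)])
      fix q u v assume "u \<in> R" "v \<in> R" "bad q u" "bad q v"
      then have "u \<in> U" "v \<in> U" "grp u = grp v" using R by (auto simp: bad_def)
      then show "u = v" by (rule block_grp_inj[OF U])
    qed
    then obtain \<sigma> where s: "inj_on \<sigma> Q" "\<sigma> ` Q \<subseteq> R"
      and s': "(\<forall>q\<in>Q. \<not> bad q (\<sigma> q)) \<or> (\<exists>q0\<in>Q. \<forall>q\<in>Q. bad q (\<sigma> q0))" by blast
    define nd where "nd i = (case t i of Node y \<Rightarrow> y | Block V \<Rightarrow> undefined)" for i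
    have nd: "t i = Node (nd i)" "nd i \<notin> U" if "out i" for i using that by (auto simp: nd_def out_def)
    from s' show ?thesis
    proof
      \<comment> \<open>All targets are now nodes outside \<open>U\<close> in the group of
        \<open>\<sigma> q\<close>, and any other group can serve for the detour.\<close>
      assume "\<exists>q0\<in>Q. \<forall>q\<in>Q. bad q (\<sigma> q0)"
      then obtain q where q: "q \<in> Q" and b: "\<And>i. i \<in> Q \<Longrightarrow> bad i (\<sigma> q)" by blast
      have sq: "\<sigma> q \<in> X" using q s R UX by auto
      obtain h where h: "h \<in> G" "h \<noteq> grp (\<sigma> q)" using ex_other_group grp_mem[OF sq] by blast
      have x: "nd i \<in> X" "nd i \<notin> U" "grp (nd i) = grp (\<sigma> q)" "t i = Node (nd i)" if i: "i \<in> Q" for i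
      proof -
        obtain y where y: "t i = Node y" "y \<notin> U" "grp y = grp (\<sigma> q)"
          using b[OF i] unfolding bad_def by blast
        then show "nd i \<in> X" "nd i \<notin> U" "grp (nd i) = grp (\<sigma> q)" "t i = Node (nd i)"
          using tv[OF i] by (simp_all add: nd_def)
      qed
      show ?thesis
        by (rule routable_detour[OF U R s le q h, of nd t "[]"]) (use x q in auto)
    next
      assume good: "\<forall>q\<in>Q. \<not> bad q (\<sigma> q)"
      \<comment> \<open>For targets that are not \<open>out\<close>, \<open>v i\<close> fixes the
        group in which the path enters \<open>W i\<close>. It is not in \<open>W i\<close>, so the
        entry node is outside \<open>U\<close>; it differs from \<open>\<sigma> i\<close>, so a
        block joins \<open>\<sigma> i\<close> to the entry node.\<close>
      define v where "v i = f (W i) (\<sigma> i)" for i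
      define x where "x i = (if out i then nd i else pt (W i) (grp (v i)))" for i
      have D: "2 \<le> card (U - W i)" if "i \<in> Q" "\<not> out i" for i using False that by auto
      have sW: "\<sigma> i \<in> U - W i" if "i \<in> Q" "\<not> out i" for i using W[OF that] s that R by auto
      have v: "v i \<in> U" "v i \<notin> W i" "v i \<noteq> \<sigma> i" if "i \<in> Q" "\<not> out i" for i
        using f[OF D[OF that]] sW[OF that] by (auto simp: v_def)
      have xo: "x i \<in> W i" "grp (x i) = grp (v i)" "x i \<in> X" "x i \<notin> U" "grp (x i) \<noteq> grp (\<sigma> i)"
        if i: "i \<in> Q" "\<not> out i" for i
      proof -
        have "v i \<in> X" using v[OF i] UX by auto
        then show 1: "x i \<in> W i" "grp (x i) = grp (v i)"
          using pt[OF W(1)[OF i]] grp_mem i by (auto simp: x_def)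
        then show "x i \<in> X" using block_subset[OF W(1)[OF i]] by auto
        show "x i \<notin> U" using block_grp_inj[OF U _ v(1)[OF i] 1(2)] 1 v[OF i] by auto
        show "grp (x i) \<noteq> grp (\<sigma> i)" using 1(2) v(1,3)[OF i] sW[OF i] block_grp_inj[OF U, of "v i" "\<sigma> i"] by auto
      qed
      show ?thesis
      proof (rule routable_direct[OF U R s, of x tail t W])
        fix i assume i: "i \<in> Q"
        show "x i \<in> X \<and> x i \<notin> U \<and> grp (x i) \<noteq> grp (\<sigma> i)"
        proof (cases "out i")
          case True
          then show ?thesis using nd[OF True] tv[OF i] good i by (auto simp: x_def bad_def)
        next
          case False
          then show ?thesis using xo i by auto
        qed
        show "(tail i = [] \<and> t i = Node (x i)) \<or>
          (W i \<in> B \<and> W i \<inter> R = {} \<and> W i \<noteq> U \<and> x i \<in> W i \<and>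
            (t i = Block (W i) \<and> tail i = [Block (W i)] \<or>
             (\<exists>y\<in>U. y \<in> W i \<and> t i = Node y \<and> tail i = [Block (W i), Node y])))"
        proof (cases "out i")
          case True
          then show ?thesis using nd[OF True] by (auto simp: x_def tail_def)
        next
          case False
          have "t i = Block (W i) \<and> tail i = [Block (W i)] \<or>
             (\<exists>y\<in>U. y \<in> W i \<and> t i = Node y \<and> tail i = [Block (W i), Node y])"
          proof (cases "t i")
            case (Node y)
            then have "y \<in> U" using False by (auto simp: out_def)
            then show ?thesis using Node False Wy[OF i _ Node] by (auto simp: tail_def)
          next
            case (Block V)
            then show ?thesis using False by (auto simp: tail_def W_def)
          qed
          then show ?thesis using W[OF i False] xo(1)[OF i False] by blast
        qed
      next
        fix i j assume i: "i \<in> Q" "tail i \<noteq> []" and j: "j \<in> Q" "tail j \<noteq> []"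
          and ij: "i \<noteq> j" and e: "W i = W j"
        have o: "\<not> out i" "\<not> out j" using i j by (auto simp: tail_def)
        show "x i \<noteq> x j"
        proof
          assume "x i = x j"
          then have "grp (v i) = grp (v j)" using xo(2)[OF i(1) o(1)] xo(2)[OF j(1) o(2)] by simp
          then have "v i = v j" using block_grp_inj[OF U v(1)[OF i(1) o(1)] v(1)[OF j(1) o(2)]] by simp
          then have "\<sigma> i = \<sigma> j"
            using f[OF D[OF i(1) o(1)]] sW[OF i(1) o(1)] sW[OF j(1) o(2)] e
            by (auto simp: v_def dest: inj_onD)
          then show False using s(1) i j ij by (auto dest: inj_onD)
        qed
      next
        fix i j y assume "i \<in> Q" "j \<in> Q" "i \<noteq> j" "y \<in> U" "t i = Node y" "t j = Node y"
        then show "W i \<noteq> W j" using w(1)[of y] by (auto simp: W_def E_def inj_on_def)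
      qed
    qed
  qed
qed

end

section \<open>Splitting the targets and assembling the paths\<close>

theorem theorem3:
  fixes k \<Delta> :: nat
    and X :: "'a set" and G B :: "'a set set"
    and U :: "'a set" and t :: "nat \<Rightarrow> 'a vertex"
  assumes "2 \<le> k" and "2 \<le> \<Delta>" and "\<Delta> \<le> k"
    and "transversal_design \<Delta> k X G B"
    and "U \<in> B"
    and "\<And>i. i \<in> {1..\<Delta>} \<Longrightarrow> t i \<in> vertices X B"
  shows "\<exists>\<pi> :: nat \<Rightarrow> 'a vertex list.
           (\<forall>i\<in>{1..\<Delta>}. path_from_to (vertices X B) (edges X B) (Block U) (\<pi> i) (t i)
                         \<and> path_length (\<pi> i) \<le> 7) \<and>
           pairwise_edge_disjoint {1..\<Delta>} \<pi>"
proof -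
  interpret transversal \<Delta> k X G B by standard (rule assms(4))
  note U = assms(5)
  have fU: "finite U" "card U = \<Delta>" using block_card U by auto
  define I where "I = {1..\<Delta>}"
  have tv: "t i \<in> vertices X B" if "i \<in> I" for i using assms(6) that by (simp add: I_def)
  define touch where "touch i v \<longleftrightarrow> v \<in> U \<and> (t i = Node v \<or> (\<exists>V. t i = Block V \<and> V \<noteq> U \<and> v \<in> V))" for i v
  \<comment> \<open>A block other than \<open>U\<close> has at most one node in common with
    \<open>U\<close>.\<close>
  have touch_unique: "v = v'" if "i \<in> I" "touch i v" "touch i v'" for i v v'
  proof (cases "t i")
    case (Block V)
    then have "V \<in> B" "V \<noteq> U" "v \<in> V" "v' \<in> V" "v \<in> U" "v' \<in> U"
      using tv[OF that(1)] that(2,3) by (simp_all add: touch_def)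
    then show ?thesis using block_eqI[OF _ U] by metis
  qed (use that in \<open>simp add: touch_def\<close>)
  define J where "J = {v\<in>U. \<exists>i\<in>I. touch i v}"
  \<comment> \<open>Preferring the node \<open>v\<close> itself matters: if some target is
    \<open>v\<close>, the direct path is just the edge from \<open>U\<close> to \<open>v\<close>,
    which leaves the other edges at \<open>v\<close> to further paths ending there.\<close>
  have "\<exists>i. i \<in> I \<and> touch i v \<and> ((\<exists>j\<in>I. t j = Node v) \<longrightarrow> t i = Node v)" if v: "v \<in> J" for v
  proof -
    obtain i where "v \<in> U" "i \<in> I" "touch i v" using v unfolding J_def by blast
    moreover have "touch j v" if "t j = Node v" for j using that \<open>v \<in> U\<close> by (simp add: touch_def)
    ultimately show ?thesis by blast
  qed
  then obtain rep where rep: "\<And>v. v \<in> J \<Longrightarrow> rep v \<in> I \<and> touch (rep v) v"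
    "\<And>v j. v \<in> J \<Longrightarrow> j \<in> I \<Longrightarrow> t j = Node v \<Longrightarrow> t (rep v) = Node v"
    by metis
  define P where "P = rep ` J"
  define Q where "Q = {i\<in>I. t i \<noteq> Block U} - P"
  define R where "R = U - J"
  have inj: "inj_on rep J" using rep(1) touch_unique unfolding inj_on_def by metis
  have PI: "P \<subseteq> {i\<in>I. t i \<noteq> Block U}"
    unfolding P_def
  proof (rule image_subsetI)
    fix v assume "v \<in> J"
    then show "rep v \<in> {i\<in>I. t i \<noteq> Block U}" using rep(1)[of v] by (auto simp: touch_def)
  qed
  have fJ: "finite J" "J \<subseteq> U" using fU by (auto simp: J_def)
  \<comment> \<open>As \<open>rep\<close> is injective, passing to \<open>Q\<close> and to
    \<open>R\<close> removes \<open>card J\<close> elements each: at most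
    \<open>\<Delta> - card J\<close> targets remain for exactly that many start nodes.\<close>
  have "card {i\<in>I. t i \<noteq> Block U} \<le> card I" by (rule card_mono) (auto simp: I_def)
  then have "card {i\<in>I. t i \<noteq> Block U} \<le> \<Delta>" by (simp add: I_def)
  moreover have "card Q = card {i\<in>I. t i \<noteq> Block U} - card P"
    unfolding Q_def by (rule card_Diff_subset) (use PI fJ P_def in auto)
  moreover have "card P = card J" using card_image[OF inj] P_def by simp
  moreover have "card R = \<Delta> - card J" unfolding R_def using fJ fU card_Diff_subset by blast
  ultimately have cQ: "card Q \<le> card R" by linarith
  have fQ: "finite Q" by (simp add: Q_def I_def)
  have "routable U R t Q"
  proof (rule routable_if_card_le[OF U _ assms(3) fQ cQ])
    show "R \<subseteq> U" by (auto simp: R_def)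
    fix i assume i: "i \<in> Q"
    show "t i \<in> vertices X B \<and> t i \<noteq> Block U" using i tv by (auto simp: Q_def)
    show "y \<notin> R" if "t i = Node y" for y using i that by (auto simp: R_def J_def Q_def touch_def)
    show "V \<inter> R = {}" if "t i = Block V" for V using i that by (auto simp: R_def J_def Q_def touch_def)
  qed
  then obtain \<rho> where \<rho>: "\<And>i. i \<in> Q \<Longrightarrow>
        path_from_to (vertices X B) (edges X B) (Block U) (\<rho> i) (t i) \<and> path_length (\<rho> i) \<le> 7"
    and \<rho>_disj: "pairwise_edge_disjoint Q \<rho>"
    and \<rho>_touch: "\<And>i x b. i \<in> Q \<Longrightarrow> {Node x, Block b} \<in> path_edges (\<rho> i) \<Longrightarrow> x \<in> U \<Longrightarrow>
        x \<in> R \<or> t i = Node x \<and> b \<noteq> U"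
    unfolding routable_def by blast
  define \<delta> where "\<delta> v = Block U # Node v # (if t (rep v) = Node v then [] else [t (rep v)])" for v
  \<comment> \<open>A target equal to \<open>Block U\<close> gets the path with one vertex, which
    has no edges to share.\<close>
  define \<pi> where "\<pi> i = (if t i = Block U then [Block U]
      else if i \<in> P then \<delta> (inv_into J rep i) else \<rho> i)" for i
  have \<pi>_rep: "\<pi> (rep v) = \<delta> v" if "v \<in> J" for v
    using that PI inv_into_f_f[OF inj that] by (auto simp: \<pi>_def P_def)
  have \<pi>_Q: "\<pi> i = \<rho> i" if "i \<in> Q" for i using that by (auto simp: \<pi>_def Q_def)
  have cases: "t i = Block U \<or> i \<in> Q \<or> (\<exists>v\<in>J. i = rep v)" if "i \<in> I" for i
    using that by (auto simp: Q_def P_def)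
  have \<delta>_path: "path_from_to (vertices X B) (edges X B) (Block U) (\<delta> v) (t (rep v)) \<and> path_length (\<delta> v) \<le> 7"
    if "v \<in> J" for v
    using rep(1)[OF that] tv[of "rep v"] U block_subset[OF U]
    by (auto simp: touch_def \<delta>_def path_from_to_def is_path_def path_length_def edge_iff)
  have \<delta>_edges: "path_edges (\<delta> v) \<subseteq> {{Node v, Block U}} \<union>
      {{Node v, Block V} |V. t (rep v) = Block V \<and> V \<noteq> U}" if "v \<in> J" for v
    using rep(1)[OF that] by (auto simp: touch_def \<delta>_def insert_commute)
  have \<delta>_\<delta>: "path_edges (\<delta> v) \<inter> path_edges (\<delta> v') = {}" if "v \<in> J" "v' \<in> J" "v \<noteq> v'" for v v'
    using \<delta>_edges[OF that(1)] \<delta>_edges[OF that(2)] that(3) by (fastforce simp: doubleton_eq_iff)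
  \<comment> \<open>If \<open>\<rho> i\<close> uses an edge at \<open>v \<in> J\<close>, then it
    ends in \<open>v\<close> and this edge does not lead to \<open>U\<close>. In that case
    \<open>rep v\<close> also has target \<open>v\<close>, so the only edge of
    \<open>\<delta> v\<close> is the one to \<open>U\<close>.\<close>
  have \<delta>_\<rho>: "path_edges (\<delta> v) \<inter> path_edges (\<rho> i) = {}" if v: "v \<in> J" and i: "i \<in> Q" for v i
  proof -
    have vU: "v \<in> U" "v \<notin> R" using v by (auto simp: J_def R_def)
    have "False" if e: "e \<in> path_edges (\<delta> v)" "e \<in> path_edges (\<rho> i)" for e
    proof -
      obtain V where V: "e = {Node v, Block V}" "V = U \<or> t (rep v) = Block V"
        using \<delta>_edges[OF v] e(1) by auto
      then have "t i = Node v" "V \<noteq> U" using \<rho>_touch[OF i, of v V] e(2) vU by auto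
      moreover have "t (rep v) = Node v" using rep(2)[OF v _ \<open>t i = Node v\<close>] i by (auto simp: Q_def)
      ultimately show False using V by auto
    qed
    then show ?thesis by blast
  qed
  have "path_from_to (vertices X B) (edges X B) (Block U) (\<pi> i) (t i) \<and> path_length (\<pi> i) \<le> 7"
    if "i \<in> I" for i
    using cases[OF that]
  proof (elim disjE bexE)
    assume "t i = Block U"
    then show ?thesis using U by (simp add: \<pi>_def path_from_to_def is_path_def path_length_def)
  next
    assume "i \<in> Q" then show ?thesis using \<rho> \<pi>_Q by simp
  next
    fix v assume "v \<in> J" "i = rep v" then show ?thesis using \<delta>_path \<pi>_rep by simp
  qed
  moreover have "path_edges (\<pi> i) \<inter> path_edges (\<pi> j) = {}" if i: "i \<in> I" and j: "j \<in> I" and ij: "i \<noteq> j" for i j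
  proof (cases "t i = Block U \<or> t j = Block U")
    case True
    then show ?thesis by (auto simp: \<pi>_def)
  next
    case False
    then consider "i \<in> Q" "j \<in> Q" | v where "v \<in> J" "i = rep v" "j \<in> Q" | v where "v \<in> J" "j = rep v" "i \<in> Q"
      | v v' where "v \<in> J" "v' \<in> J" "i = rep v" "j = rep v'"
      using cases[OF i] cases[OF j] by blast
    then show ?thesis
    proof cases
      case 1
      then show ?thesis using \<rho>_disj ij \<pi>_Q
        by (auto simp: pairwise_edge_disjoint_def disjoint_family_on_def)
    next
      case 2
      then show ?thesis using \<delta>_\<rho> \<pi>_rep \<pi>_Q by simp
    next
      case 3
      then show ?thesis using \<delta>_\<rho> \<pi>_rep \<pi>_Q by (simp add: Int_commute)
    next
      case 4
      then show ?thesis using \<delta>_\<delta>[of v v'] \<pi>_rep ij by auto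
    qed
  qed
  ultimately show ?thesis
    unfolding pairwise_edge_disjoint_def disjoint_family_on_def I_def by blast
qed

end
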